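(* Let $A=A^+\cup\{\beta\}\subset\mathbb{R}^n$ be a circuit with $A^+=\{\alpha_0,\ldots,\alpha_n\}$ and $\beta=0$, and barycentric coordinates $\lambda\in(0,1)^{n+1}$. Let $(\mathbf{1},-1)\in\mathbb{R}^{n+2}$ denote the all-1-vector with a single negative sign in the last entry (the entry corresponding to $\beta$). Then the DSONC cone $D_{A^+,\beta}$ satisfies $$D_{A^+,\beta}=\big\{\langle G(w,\varphi_A(x)),\,t\cdot(\mathbf{1},-1)\rangle\in\mathbb{R}^A\ :\ w\in\mathbb{R}^n,\ t\in\mathbb{R}_{>0}\big\},$$ where $\langle G(w,\varphi_A(x)),t\cdot(\mathbf{1},-1)\rangle=t\big(\sum_{j=0}^n e^{\langle x-w,\alpha_j\rangle}-e^{\langle x-w,\beta\rangle}\big)$. Hereby, the action $G$ moves the equilibrium point from the origin to an arbitrary point in $\mathbb{R}^n$ and adjusts the coefficients $c_j$ (at $\alpha_j$) and $c_\beta$ (at $\beta$) of the resulting function $f$ such that the equation $$|c_\beta|=c_0e^{\langle \mathrm{eq}(f),\alpha_0-\beta\rangle}=\cdots=c_ne^{\langle \mathrm{eq}(f),\alpha_n-\beta\rangle}$$ still holds.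
   Context: Circuit here means: $A^+=\{\alpha_0,\dots,\alpha_n\}\subset\mathbb{R}^n$ is affinely independent and $\beta$ lies in the interior of the simplex $\mathrm{conv}(A^+)$; the barycentric coordinates are the unique $\lambda\in(0,1)^{n+1}$ with $\sum_j\lambda_j\alpha_j=\beta$ and $\sum_j\lambda_j=1$. $\mathbb{R}^A\cong\mathbb{R}^{n+2}$ is the space of exponential sums $\sum_{j=0}^nc_je^{\langle x,\alpha_j\rangle}+c_\beta e^{\langle x,\beta\rangle}$ with real coefficients, $x\in\mathbb{R}^n$. DSONC cone of the circuit: $D_{A^+,\beta}$ is the set of all exponential sums $\sum_jc_je^{\langle x,\alpha_j\rangle}+c_\beta e^{\langle x,\beta\rangle}$ with $c_j\ge0$ for all $j$ and $-c_\beta\le\prod_{j=0}^nc_j^{\lambda_j}$. Toric morphism and group action: $\varphi_A(x)=(e^{\langle x,\alpha_0\rangle},\dots,e^{\langle x,\alpha_n\rangle},e^{\langle x,\beta\rangle})\in\mathbb{R}^{n+2}$, so that every element of $\mathbb{R}^A$ has the form $\langle\varphi_A(x),c\rangle$ with $c\in\mathbb{R}^{n+2}$. The group action $G$ of $\mathbb{R}^n$ is translation of the variable, $(w,f)\mapsto f(x-w)$; applied to $\varphi_A$ this means $G(w,\varphi_A(x))=\varphi_A(x-w)$. Point of equilibrium: for a circuit function $f(x)=\sum_{j=0}^nc_je^{\langle x,\alpha_j\rangle}+c_\beta e^{\langle x,\beta\rangle}$ with support $A$ (so $c_j>0$ for all $j$ and $c_\beta\neq0$), $\mathrm{eq}(f)\in\mathbb{R}^n$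 is the unique point satisfying $c_0e^{\langle\mathrm{eq}(f),\alpha_0-\beta\rangle}=\cdots=c_ne^{\langle\mathrm{eq}(f),\alpha_n-\beta\rangle}$.
   Formalization: The stated equality fails (the zero function lies in D but not in the right-hand set); proved instead: the right-hand set is the part of the boundary of D with full support A, and D consists of the nonnegative-coefficient sums P together with (right-hand set)+P. *)

theory Defs
  imports "HOL-Analysis.Analysis"
begin

definition circuit :: "('k::finite \<Rightarrow> real ^ 'n) \<Rightarrow> real ^ 'n \<Rightarrow> bool" where
  "circuit \<alpha> \<beta> \<longleftrightarrow>
     CARD('k) = CARD('n) + 1 \<and> inj \<alpha> \<and> \<not> affine_dependent (range \<alpha>) \<and>
     \<beta> \<in> interior (convex hull (range \<alpha>))"

definition barycentric :: "('k::finite \<Rightarrow> real ^ 'n) \<Rightarrow> real ^ 'n \<Rightarrow> ('k \<Rightarrow> real) \<Rightarrow> bool" where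
  "barycentric \<alpha> \<beta> lam \<longleftrightarrow>
     (\<forall>j. 0 < lam j \<and> lam j < 1) \<and> (\<Sum>j\<in>UNIV. lam j) = 1 \<and> (\<Sum>j\<in>UNIV. lam j *\<^sub>R \<alpha> j) = \<beta>"

text \<open>
  The space of coefficients is \<^typ>\<open>(real ^ 'k) \<times> real\<close>, with \<^typ>\<open>'k\<close> having
  \<open>n + 1\<close> elements: the first component holds the coefficients at the vertices \<open>\<alpha> j\<close>, the
  second one the coefficient at \<open>\<beta>\<close>. The library's inner product and topology on it are those
  of the Euclidean space of dimension \<open>n + 2\<close>.
\<close>

definition toric :: "('k::finite \<Rightarrow> real ^ 'n) \<Rightarrow> real ^ 'n \<Rightarrow> real ^ 'n \<Rightarrow> (real ^ 'k) \<times> real" where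
  "toric \<alpha> \<beta> x = ((\<chi> j. exp (x \<bullet> \<alpha> j)), exp (x \<bullet> \<beta>))"

definition expsum :: "('k::finite \<Rightarrow> real ^ 'n) \<Rightarrow> real ^ 'n \<Rightarrow> (real ^ 'k) \<times> real \<Rightarrow> real ^ 'n \<Rightarrow> real" where
  "expsum \<alpha> \<beta> c x = toric \<alpha> \<beta> x \<bullet> c"

lemma expsum_eq:
  "expsum \<alpha> \<beta> c x = (\<Sum>j\<in>UNIV. fst c $ j * exp (x \<bullet> \<alpha> j)) + snd c * exp (x \<bullet> \<beta>)"
  by (cases c) (simp add: expsum_def toric_def inner_prod_def inner_vec_def mult.commute)

definition translate :: "real ^ 'n \<Rightarrow> (real ^ 'n \<Rightarrow> 'b) \<Rightarrow> real ^ 'n \<Rightarrow> 'b" where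
  "translate w f = (\<lambda>x. f (x - w))"

definition DSONC :: "('k::finite \<Rightarrow> real ^ 'n) \<Rightarrow> real ^ 'n \<Rightarrow> ('k \<Rightarrow> real) \<Rightarrow> (real ^ 'n \<Rightarrow> real) set" where
  "DSONC \<alpha> \<beta> lam =
     {expsum \<alpha> \<beta> c | c. (\<forall>j. 0 \<le> fst c $ j) \<and> - snd c \<le> (\<Prod>j\<in>UNIV. (fst c $ j) powr lam j)}"

definition equilibrium :: "('k::finite \<Rightarrow> real ^ 'n) \<Rightarrow> real ^ 'n \<Rightarrow> (real ^ 'k) \<times> real \<Rightarrow> real ^ 'n" where
  "equilibrium \<alpha> \<beta> c =
     (THE y. \<forall>i j. fst c $ i * exp (y \<bullet> (\<alpha> i - \<beta>)) = fst c $ j * exp (y \<bullet> (\<alpha> j - \<beta>)))"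

lemma orbit_term:
  "translate w (toric \<alpha> \<beta>) x \<bullet> (t *\<^sub>R (1, -1)) =
     t * ((\<Sum>j\<in>UNIV. exp ((x - w) \<bullet> \<alpha> j)) - exp ((x - w) \<bullet> \<beta>))"
  by (simp add: translate_def toric_def inner_prod_def inner_vec_def sum_distrib_left algebra_simps)

definition nonneg_expsums :: "('k::finite \<Rightarrow> real ^ 'n) \<Rightarrow> real ^ 'n \<Rightarrow> (real ^ 'n \<Rightarrow> real) set" where
  "nonneg_expsums \<alpha> \<beta> = {expsum \<alpha> \<beta> c | c. (\<forall>j. 0 \<le> fst c $ j) \<and> 0 \<le> snd c}"

text \<open>
  Members of \<open>S\<close> with support exactly \<open>A\<close> on the boundary of \<open>S\<close>. The frontier is taken in the
  coefficient space: in the type of all functions the exponential sums have empty interior.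
\<close>

definition full_support_boundary ::
    "('k::finite \<Rightarrow> real ^ 'n) \<Rightarrow> real ^ 'n \<Rightarrow> (real ^ 'n \<Rightarrow> real) set \<Rightarrow> (real ^ 'n \<Rightarrow> real) set" where
  "full_support_boundary \<alpha> \<beta> S =
     {expsum \<alpha> \<beta> c | c. expsum \<alpha> \<beta> c \<in> S \<and> c \<in> frontier (expsum \<alpha> \<beta> -` S) \<and>
        (\<forall>j. fst c $ j \<noteq> 0) \<and> snd c \<noteq> 0}"

text \<open>
  The orbit of the multiples of \<open>(1, -1)\<close> is not the whole cone: the cone contains the zero function, the orbit does not (nor
  does it contain any function with nonnegative coefficient at \<open>\<beta>\<close> or from the interior of the
  cone). It parametrizes only the part of the boundary with full support; the remaining
  elements of the cone arise by adding exponential sums with nonnegative coefficients.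
\<close>

lemma DSONC_neq_orbit:
  fixes \<alpha> :: "'k::finite \<Rightarrow> real ^ 'n"
  assumes "circuit \<alpha> \<beta>"
  shows "DSONC \<alpha> \<beta> lam \<noteq>
    {(\<lambda>x. translate w (toric \<alpha> \<beta>) x \<bullet> (t *\<^sub>R (1, -1))) | w t. 0 < t}" (is "_ \<noteq> ?O")
proof -
  have "expsum \<alpha> \<beta> 0 \<in> DSONC \<alpha> \<beta> lam"
    unfolding DSONC_def by (rule CollectI, rule exI[of _ 0]) (simp add: prod_nonneg)
  moreover have "expsum \<alpha> \<beta> 0 \<notin> ?O"
  proof
    assume "expsum \<alpha> \<beta> 0 \<in> ?O"
    then obtain w t where t: "0 < t"
      and eq: "expsum \<alpha> \<beta> 0 = (\<lambda>x. translate w (toric \<alpha> \<beta>) x \<bullet> (t *\<^sub>R (1, -1)))"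
      by blast
    from fun_cong[OF eq, of w] have "0 = t * (real CARD('k) - 1)"
      by (simp only: orbit_term) (simp add: expsum_def)
    moreover have "CARD('k) = CARD('n) + 1" using assms by (simp add: circuit_def)
    ultimately show False using t by simp
  qed
  ultimately show ?thesis by blast
qed

end

theory Submission
  imports Defs
begin

text \<open>
  Taking logarithms, the orbit of \<open>t (1, -1)\<close> under translation consists of the coefficient vectors
  with \<open>c\<^sub>\<beta> = -t\<close> and \<open>ln c\<^sub>j = ln t - \<langle>w, \<alpha>\<^sub>j\<rangle>\<close>. The linear map sending \<open>w\<close> to the vector of all
  \<open>\<langle>w, \<alpha>\<^sub>j\<rangle>\<close> is an isomorphism onto the hyperplane orthogonal to \<open>\<lambda>\<close>, so the orbits are exactly the
  coefficient vectors with \<open>c\<^sub>j > 0\<close> and \<open>-c\<^sub>\<beta> = \<Prod> c\<^sub>j\<^bsup>\<lambda>\<^sub>j\<^esup> > 0\<close>. Any other element of the cone with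
  \<open>c\<^sub>\<beta> < 0\<close> lies above one of these, obtained by shrinking all \<open>c\<^sub>j\<close> by a common factor.
\<close>

locale origin_circuit =
  fixes \<alpha> :: "'k::finite \<Rightarrow> real ^ 'n" and lam :: "'k \<Rightarrow> real"
  assumes circuit: "circuit \<alpha> 0" and barycentric: "barycentric \<alpha> 0 lam"
begin

section \<open>Barycentric relation and inner products with the vertices\<close>

lemma lam_pos: "0 < lam j" and lam_less_1: "lam j < 1"
  and sum_lam: "(\<Sum>j\<in>UNIV. lam j) = 1" and sum_lam_vertices: "(\<Sum>j\<in>UNIV. lam j *\<^sub>R \<alpha> j) = 0"
  using barycentric by (auto simp: barycentric_def)

lemma sum_lam_inner: "(\<Sum>j\<in>UNIV. lam j * (w \<bullet> \<alpha> j)) = 0"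
proof -
  have "(\<Sum>j\<in>UNIV. lam j * (w \<bullet> \<alpha> j)) = w \<bullet> (\<Sum>j\<in>UNIV. lam j *\<^sub>R \<alpha> j)"
    by (simp add: inner_sum_right)
  then show ?thesis by (simp add: sum_lam_vertices)
qed

text \<open>Otherwise the simplex would lie in a hyperplane and have empty interior, while the
  circuit has the origin inside it.\<close>

lemma inner_vertices_eq_0:
  assumes "\<And>j. w \<bullet> \<alpha> j = 0"
  shows "w = 0"
proof (rule ccontr)
  assume w: "w \<noteq> 0"
  have "range \<alpha> \<subseteq> {x. w \<bullet> x = 0}" using assms by auto
  then have "convex hull range \<alpha> \<subseteq> {x. w \<bullet> x = 0}"
    by (rule hull_minimal) (rule convex_hyperplane)
  then have "interior (convex hull range \<alpha>) \<subseteq> interior {x. w \<bullet> x = 0}"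
    by (rule interior_mono)
  also have "interior {x. w \<bullet> x = 0} = {}"
    using w by (intro interior_hyperplane) auto
  finally show False using circuit by (auto simp: circuit_def)
qed

text \<open>A common value equals its own \<open>lam\<close>-weighted mean, which vanishes. This
  gives uniqueness of the equilibrium point.\<close>

lemma inner_vertices_const:
  assumes "\<And>i j. w \<bullet> \<alpha> i = w \<bullet> \<alpha> j"
  shows "w = 0"
proof (rule inner_vertices_eq_0)
  fix i
  have "0 = (\<Sum>j\<in>UNIV. lam j * (w \<bullet> \<alpha> j))" by (simp add: sum_lam_inner)
  also have "\<dots> = (\<Sum>j\<in>UNIV. lam j * (w \<bullet> \<alpha> i))" using assms by metis
  also have "\<dots> = w \<bullet> \<alpha> i" by (simp add: sum_distrib_right[symmetric] sum_lam)
  finally show "w \<bullet> \<alpha> i = 0" by simp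
qed

text \<open>Dimension count: \<open>L\<close> is injective, so its range has the same dimension as
  the hyperplane containing it.\<close>

lemma inner_vertices_onto:
  assumes b: "(\<Sum>j\<in>UNIV. lam j * b j) = 0"
  obtains w where "\<And>j. w \<bullet> \<alpha> j = b j"
proof -
  define L :: "real ^ 'n \<Rightarrow> real ^ 'k" where "L w = (\<chi> j. w \<bullet> \<alpha> j)" for w
  define l :: "real ^ 'k" where "l = (\<chi> j. lam j)"
  have lin: "linear L"
    by (rule linearI) (simp_all add: L_def vec_eq_iff inner_left_distrib)
  have l0: "l \<noteq> 0" using lam_pos by (auto simp: l_def vec_eq_iff less_le)
  have sub: "range L \<subseteq> {x. l \<bullet> x = 0}"
    using sum_lam_inner by (auto simp: L_def l_def inner_vec_def[where 'b='k])
  have inj: "inj L"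
    unfolding linear_injective_0[OF lin]
    using inner_vertices_eq_0 by (simp add: L_def vec_eq_iff[where 'b='k])
  have "dim (range L) = CARD('n)"
    using dim_image_eq[OF lin, of UNIV] inj by simp
  also have "\<dots> = dim {x. l \<bullet> x = 0}"
    using dim_hyperplane[OF l0] circuit by (simp add: circuit_def)
  finally have "range L = {x. l \<bullet> x = 0}"
    using sub by (intro subspace_dim_equal linear_subspace_image lin subspace_hyperplane) auto
  moreover have "(\<chi> j. b j) \<in> {x. l \<bullet> x = 0}" using b by (simp add: l_def inner_vec_def)
  ultimately obtain w where "L w = (\<chi> j. b j)" by (metis imageE)
  then show ?thesis using that[of w] by (simp add: L_def vec_eq_iff)
qed

section \<open>Linear independence of the exponentials\<close>

text \<open>
  Restricting to lines along which all but one of the exponents agree reduces the linear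
  independence of the exponentials to that of three functions, evaluated at arguments \<open>0, 1, 2\<close>.
\<close>

lemma expsum_eq_0:
  assumes "expsum \<alpha> 0 c = (\<lambda>x. 0)"
  shows "c = 0"
proof -
  define S where "S = (\<Sum>j\<in>UNIV. fst c $ j)"
  define d where "d = snd c"
  have line: "fst c $ k * exp s + (S - fst c $ k) + d * exp (s * lam k) = 0" for k s
  proof -
    \<comment> \<open>Along this direction all exponents but the \<open>k\<close>-th equal
      \<open>- s * lam k\<close>; multiplying by \<open>exp (s * lam k)\<close> turns them into 0
      and the \<open>k\<close>-th into \<open>s\<close>.\<close>
    define b where "b j = s * ((if j = k then 1 else 0) - lam k)" for j
    have "(\<Sum>j\<in>UNIV. lam j * b j) = 
        (\<Sum>j\<in>UNIV. (if j = k then s * lam j else 0) - lam j * (s * lam k))"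
      by (rule sum.cong) (auto simp: b_def algebra_simps)
    also have "\<dots> = 0"
      by (simp add: sum_subtractf sum_distrib_right[symmetric] sum_lam)
    finally obtain w where w: "\<And>j. w \<bullet> \<alpha> j = b j" using inner_vertices_onto by metis
    have "0 = exp (s * lam k) * expsum \<alpha> 0 c w" using assms by simp
    also have "\<dots> = (\<Sum>j\<in>UNIV. fst c $ j * (exp (s * lam k) * exp (b j))) + d * exp (s * lam k)"
      by (simp add: expsum_eq w d_def algebra_simps sum_distrib_left)
    also have "(\<Sum>j\<in>UNIV. fst c $ j * (exp (s * lam k) * exp (b j))) =
        (\<Sum>j\<in>UNIV. fst c $ j + (if j = k then fst c $ j * (exp s - 1) else 0))"
      by (rule sum.cong) (auto simp: b_def algebra_simps simp flip: exp_add)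
    also have "\<dots> = S + fst c $ k * (exp s - 1)"
      by (simp add: sum.distrib S_def)
    finally show ?thesis by (simp add: algebra_simps)
  qed
  have c0: "fst c $ k = 0 \<and> d = 0" for k
  proof -
    define X where "X = exp (1::real)"
    define Y where "Y = exp (lam k)"
    have neq: "X \<noteq> 1" "Y \<noteq> 1" "X \<noteq> Y"
      using lam_pos[of k] lam_less_1[of k] by (auto simp: X_def Y_def)
    have sq: "exp 2 = X * X" "exp (2 * lam k) = Y * Y"
      by (simp_all add: X_def Y_def flip: exp_add)
    \<comment> \<open>The case \<open>s = 0\<close> removes \<open>S\<close> from the other two
      equations; subtracting \<open>Y + 1\<close> times \<open>1\<close> from \<open>2\<close> then
      removes \<open>d\<close>.\<close>
    have 0: "S + d = 0" using line[of k 0] by simp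
    have 1: "fst c $ k * (X - 1) + d * (Y - 1) = 0"
      using line[of k 1] 0 by (simp add: X_def Y_def algebra_simps)
    have 2: "fst c $ k * (X * X - 1) + d * (Y * Y - 1) = 0"
      using line[of k 2] 0 unfolding sq by (simp add: algebra_simps)
    have "fst c $ k * (X - 1) * (X - Y) = 0" using 1 2 by algebra
    then have "fst c $ k = 0" using neq by simp
    with 1 neq show ?thesis by simp
  qed
  then show ?thesis by (auto simp: prod_eq_iff vec_eq_iff d_def)
qed

text \<open>Lets functions be identified with coefficient vectors, so that frontiers and equilibria
  can be computed on coefficients.\<close>

lemma inj_expsum: "inj (expsum \<alpha> 0)"
proof (rule injI)
  fix c d :: "(real ^ 'k) \<times> real"
  assume "expsum \<alpha> 0 c = expsum \<alpha> 0 d"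
  then have "expsum \<alpha> 0 (c - d) = (\<lambda>x. 0)"
    by (auto simp: expsum_def inner_diff_right fun_eq_iff)
  then show "c = d" using expsum_eq_0 by fastforce
qed

section \<open>Coefficients along the orbit\<close>

text \<open>Translation rescales the coefficients at the vertices only; the last one stays
  \<open>- t\<close> because \<beta> is the origin.\<close>

definition orbit_coeff :: "real ^ 'n \<Rightarrow> real \<Rightarrow> (real ^ 'k) \<times> real" where
  "orbit_coeff w t = ((\<chi> j. t * exp (- (w \<bullet> \<alpha> j))), - t)"

lemma expsum_orbit_coeff:
  "expsum \<alpha> 0 (orbit_coeff w t) x = translate w (toric \<alpha> 0) x \<bullet> (t *\<^sub>R (1, -1))"
  unfolding orbit_term
  by (auto simp: expsum_eq orbit_coeff_def inner_diff_left exp_diff exp_minus sum_distrib_left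
      field_simps)

text \<open>The translation factors cancel in the weighted geometric mean by
  \<open>sum_lam_inner\<close>.\<close>

lemma prod_powr_orbit:
  assumes "0 < t"
  shows "(\<Prod>j\<in>UNIV. (fst (orbit_coeff w t) $ j) powr lam j) = t"
proof -
  have "(\<Prod>j\<in>UNIV. (fst (orbit_coeff w t) $ j) powr lam j) =
      (\<Prod>j\<in>UNIV. exp (ln t * lam j - lam j * (w \<bullet> \<alpha> j)))"
    using assms by (intro prod.cong) (auto simp: orbit_coeff_def powr_def ln_mult algebra_simps)
  also have "\<dots> = exp (\<Sum>j\<in>UNIV. ln t * lam j - lam j * (w \<bullet> \<alpha> j))"
    by (simp add: exp_sum)
  also have "(\<Sum>j\<in>UNIV. ln t * lam j - lam j * (w \<bullet> \<alpha> j)) = ln t"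
    by (simp add: sum_subtractf sum_lam_inner sum_distrib_left[symmetric] sum_lam)
  finally show ?thesis using assms by simp
qed

text \<open>After taking logarithms, the product equation is exactly the solvability condition of
  \<open>inner_vertices_onto\<close>.\<close>

lemma orbit_coeffI:
  assumes pos: "\<And>j. 0 < fst c $ j" and eq: "- snd c = (\<Prod>j\<in>UNIV. (fst c $ j) powr lam j)"
  obtains w where "c = orbit_coeff w (- snd c)"
proof -
  define t where "t = - snd c"
  have t: "0 < t" unfolding t_def eq using pos by (intro prod_pos) (auto simp: less_imp_neq[symmetric])
  have "ln t = (\<Sum>j\<in>UNIV. lam j * ln (fst c $ j))"
    unfolding t_def eq using pos by (subst ln_prod) (auto simp: ln_powr less_imp_neq[symmetric])
  then have "(\<Sum>j\<in>UNIV. lam j * (ln t - ln (fst c $ j))) = 0"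
    by (simp add: right_diff_distrib sum_subtractf sum_distrib_right[symmetric] sum_lam)
  then obtain w where w: "\<And>j. w \<bullet> \<alpha> j = ln t - ln (fst c $ j)"
    using inner_vertices_onto by metis
  have "c = orbit_coeff w t"
    using t pos by (cases c) (auto simp: orbit_coeff_def w vec_eq_iff exp_diff t_def)
  then show ?thesis using that t_def by simp
qed

section \<open>Boundary of the cone in coefficient space\<close>

definition cone_coeff :: "((real ^ 'k) \<times> real) set" where
  "cone_coeff = {c. (\<forall>j. 0 \<le> fst c $ j) \<and> - snd c \<le> (\<Prod>j\<in>UNIV. (fst c $ j) powr lam j)}"

lemma DSONC_eq_image: "DSONC \<alpha> 0 lam = expsum \<alpha> 0 ` cone_coeff"
  unfolding DSONC_def cone_coeff_def by blast

lemma orbit_coeff_in_cone: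
  assumes "0 < t"
  shows "orbit_coeff w t \<in> cone_coeff"
  unfolding cone_coeff_def using prod_powr_orbit[OF assms] assms
  by (simp add: orbit_coeff_def)

lemma vimage_DSONC: "expsum \<alpha> 0 -` DSONC \<alpha> 0 lam = cone_coeff"
  by (simp add: DSONC_eq_image inj_vimage_image_eq inj_expsum)

text \<open>Strict inequalities between continuous functions persist in a neighbourhood.\<close>

lemma interior_cone_coeffI:
  assumes "\<And>j. 0 < fst c $ j" and "- snd c < (\<Prod>j\<in>UNIV. (fst c $ j) powr lam j)"
  shows "c \<in> interior cone_coeff"
proof -
  \<comment> \<open>The truncation by \<open>max\<close> makes the product continuous on the whole space.\<close>
  define U :: "((real ^ 'k) \<times> real) set" where
    "U = (\<Inter>j. {c. 0 < fst c $ j}) \<inter> {c. - snd c < (\<Prod>j\<in>UNIV. (max 0 (fst c $ j)) powr lam j)}"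
  have "open U"
    unfolding U_def using lam_pos
    by (intro open_Int open_INT open_Collect_less continuous_intros continuous_on_powr' ballI finite)
      (auto simp: less_imp_neq[symmetric])
  moreover have "c \<in> U" using assms by (auto simp: U_def max_def less_imp_le)
  moreover have "U \<subseteq> cone_coeff" by (auto simp: U_def cone_coeff_def max_def less_imp_le)
  ultimately show ?thesis by (auto simp: interior_def)
qed

lemma frontier_cone_coeff_orbit:
  assumes t: "0 < t"
  shows "orbit_coeff w t \<in> frontier cone_coeff"
proof -
  have "orbit_coeff w t \<in> cone_coeff"
    using t by (rule orbit_coeff_in_cone)
  moreover have "orbit_coeff w t \<notin> interior cone_coeff"
  proof
    assume "orbit_coeff w t \<in> interior cone_coeff"
    then obtain e where e: "0 < e" "cball (orbit_coeff w t) e \<subseteq> cone_coeff"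
      by (meson mem_interior_cball)
    \<comment> \<open>On the orbit the product bound is an equality, so lowering the coefficient at
      \<beta> leaves the cone.\<close>
    have "orbit_coeff w t + (0, - e) \<in> cball (orbit_coeff w t) e"
      using e by (simp add: dist_norm norm_Pair)
    then have "orbit_coeff w t + (0, - e) \<in> cone_coeff" using e by blast
    then show False
      using prod_powr_orbit[OF t, of w] e by (simp add: cone_coeff_def) (simp add: orbit_coeff_def)
  qed
  ultimately show ?thesis using closure_subset by (auto simp: frontier_def)
qed

text \<open>Full support makes all vertex coefficients positive; not being interior then forces
  equality in the product bound.\<close>

lemma full_support_boundary_eq_orbit:
  "full_support_boundary \<alpha> 0 (DSONC \<alpha> 0 lam) = {expsum \<alpha> 0 (orbit_coeff w t) | w t. 0 < t}"
proof (intro equalityI subsetI)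
  fix f assume "f \<in> full_support_boundary \<alpha> 0 (DSONC \<alpha> 0 lam)"
  then obtain c where f: "f = expsum \<alpha> 0 c" and c: "c \<in> cone_coeff" "c \<in> frontier cone_coeff"
      "\<And>j. fst c $ j \<noteq> 0"
    unfolding full_support_boundary_def vimage_DSONC using vimage_DSONC by blast
  have pos: "0 < fst c $ j" for j using c(1) c(3)[of j] by (simp add: cone_coeff_def less_le)
  have "\<not> - snd c < (\<Prod>j\<in>UNIV. (fst c $ j) powr lam j)"
    using interior_cone_coeffI[of c] pos c(2) by (auto simp: frontier_def)
  then have eq: "- snd c = (\<Prod>j\<in>UNIV. (fst c $ j) powr lam j)"
    using c(1) by (simp add: cone_coeff_def)
  moreover have "0 < (\<Prod>j\<in>UNIV. (fst c $ j) powr lam j)"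
    using c(3) by (intro prod_pos) auto
  ultimately have "0 < - snd c" by metis
  moreover obtain w where "c = orbit_coeff w (- snd c)" using orbit_coeffI[OF pos eq] .
  ultimately show "f \<in> {expsum \<alpha> 0 (orbit_coeff w t) | w t. 0 < t}"
    unfolding f by (metis (mono_tags, lifting) mem_Collect_eq)
next
  fix f assume "f \<in> {expsum \<alpha> 0 (orbit_coeff w t) | w t. 0 < t}"
  then obtain w t where f: "f = expsum \<alpha> 0 (orbit_coeff w t)" and t: "0 < t" by blast
  have "orbit_coeff w t \<in> cone_coeff"
    using t by (rule orbit_coeff_in_cone)
  then have "f \<in> DSONC \<alpha> 0 lam" by (simp add: f DSONC_eq_image)
  moreover have "(\<forall>j. fst (orbit_coeff w t) $ j \<noteq> 0) \<and> snd (orbit_coeff w t) \<noteq> 0"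
    using t by (simp add: orbit_coeff_def)
  ultimately show "f \<in> full_support_boundary \<alpha> 0 (DSONC \<alpha> 0 lam)"
    unfolding full_support_boundary_def vimage_DSONC
    using f frontier_cone_coeff_orbit[OF t, of w] by blast
qed

section \<open>Decomposition of the cone\<close>

lemma expsum_add: "expsum \<alpha> 0 (c + d) = (\<lambda>x. expsum \<alpha> 0 c x + expsum \<alpha> 0 d x)"
  by (simp add: expsum_def inner_add_right fun_eq_iff)

lemma cone_coeff_above_orbit:
  assumes c: "c \<in> cone_coeff" and neg: "snd c < 0"
  obtains w d where "c = orbit_coeff w (- snd c) + d" "\<And>j. 0 \<le> fst d $ j" "snd d = 0"
proof -
  define P where "P = (\<Prod>j\<in>UNIV. (fst c $ j) powr lam j)"
  have le: "- snd c \<le> P" and nonneg: "\<And>j. 0 \<le> fst c $ j"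
    using c by (auto simp: cone_coeff_def P_def)
  have P: "0 < P" using le neg by simp
  have "fst c $ j \<noteq> 0" for j
  proof
    assume "fst c $ j = 0"
    then have "P = 0" unfolding P_def by (intro prod_zero) auto
    with P show False by simp
  qed
  with nonneg have pos: "\<And>j. 0 < fst c $ j" by (simp add: less_le)
  \<comment> \<open>Since \<open>lam\<close> sums to 1, scaling the vertex coefficients by
    \<open>s\<close> scales the product by \<open>s\<close>, bringing it down to
    \<open>- snd c\<close>; \<open>s \<le> 1\<close> keeps the remainder nonnegative.\<close>
  define s where "s = - snd c / P"
  have s: "0 < s" "s \<le> 1" using neg P le by (auto simp: s_def field_simps)
  define c' where "c' = (s *\<^sub>R fst c, snd c)"
  have "(\<Prod>j\<in>UNIV. (fst c' $ j) powr lam j) = (\<Prod>j\<in>UNIV. s powr lam j) * P"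
    unfolding c'_def P_def prod.distrib[symmetric]
    using s nonneg by (intro prod.cong) (auto simp: powr_mult)
  also have "(\<Prod>j\<in>UNIV. s powr lam j) = s"
    using s by (simp add: sum_lam flip: powr_sum)
  also have "s * P = - snd c'" using P by (simp add: s_def c'_def)
  finally have "- snd c' = (\<Prod>j\<in>UNIV. (fst c' $ j) powr lam j)" by simp
  then obtain w where w: "c' = orbit_coeff w (- snd c')"
    using orbit_coeffI[of c'] s pos by (auto simp: c'_def)
  show ?thesis
  proof (rule that)
    show "c = orbit_coeff w (- snd c) + (c - c')" using w by (simp add: c'_def)
    show "0 \<le> fst (c - c') $ j" for j
      using s nonneg[of j] by (simp add: c'_def mult_left_le_one_le)
    show "snd (c - c') = 0" by (simp add: c'_def)
  qed
qed

text \<open>The product is monotone in each coefficient, as the exponents are positive.\<close>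

lemma orbit_coeff_add_in_cone:
  assumes t: "0 < t" and d: "\<And>j. 0 \<le> fst d $ j" "0 \<le> snd d"
  shows "orbit_coeff w t + d \<in> cone_coeff"
proof -
  have nonneg: "0 \<le> fst (orbit_coeff w t) $ j" for j using t by (simp add: orbit_coeff_def)
  have "- snd (orbit_coeff w t + d) \<le> t" using d by (simp add: orbit_coeff_def)
  also have "t = (\<Prod>j\<in>UNIV. (fst (orbit_coeff w t) $ j) powr lam j)"
    by (simp add: prod_powr_orbit t)
  also have "\<dots> \<le> (\<Prod>j\<in>UNIV. (fst (orbit_coeff w t + d) $ j) powr lam j)"
    using nonneg d lam_pos by (intro prod_mono) (auto intro!: powr_mono2 simp: less_imp_le)
  finally show ?thesis using nonneg d by (simp add: cone_coeff_def)
qed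

text \<open>The sign of the coefficient at \<beta> decides which of the two sets a member of the
  cone is placed in.\<close>

lemma DSONC_eq_orbit_plus_nonneg:
  "DSONC \<alpha> 0 lam = nonneg_expsums \<alpha> 0 \<union>
     {(\<lambda>x. expsum \<alpha> 0 (orbit_coeff w t) x + h x) | w t h. 0 < t \<and> h \<in> nonneg_expsums \<alpha> 0}"
    (is "_ = _ \<union> ?O")
proof (intro equalityI subsetI)
  fix f assume "f \<in> DSONC \<alpha> 0 lam"
  then obtain c where f: "f = expsum \<alpha> 0 c" and c: "c \<in> cone_coeff"
    by (auto simp: DSONC_eq_image)
  show "f \<in> nonneg_expsums \<alpha> 0 \<union> ?O"
  proof (cases "0 \<le> snd c")
    case True
    then have "f \<in> nonneg_expsums \<alpha> 0"
      using f c unfolding nonneg_expsums_def cone_coeff_def by blast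
    then show ?thesis ..
  next
    case False
    then obtain w d where "c = orbit_coeff w (- snd c) + d" and d: "\<And>j. 0 \<le> fst d $ j" "snd d = 0"
      using cone_coeff_above_orbit[OF c] by auto
    then have "f = (\<lambda>x. expsum \<alpha> 0 (orbit_coeff w (- snd c)) x + expsum \<alpha> 0 d x)"
      unfolding f expsum_add[symmetric] by metis
    moreover have "expsum \<alpha> 0 d \<in> nonneg_expsums \<alpha> 0"
      unfolding nonneg_expsums_def using d by (intro CollectI exI[of _ d]) simp
    moreover have "0 < - snd c" using False by simp
    ultimately show ?thesis by blast
  qed
next
  fix f assume "f \<in> nonneg_expsums \<alpha> 0 \<union> ?O"
  then show "f \<in> DSONC \<alpha> 0 lam"
  proof
    assume "f \<in> nonneg_expsums \<alpha> 0"
    then obtain c where f: "f = expsum \<alpha> 0 c" and c: "\<And>j. 0 \<le> fst c $ j" "0 \<le> snd c"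
      by (auto simp: nonneg_expsums_def)
    have "- snd c \<le> 0" using c by simp
    also have "0 \<le> (\<Prod>j\<in>UNIV. (fst c $ j) powr lam j)" by (intro prod_nonneg) simp
    finally have "c \<in> cone_coeff" using c by (simp add: cone_coeff_def)
    then show ?thesis by (simp add: f DSONC_eq_image)
  next
    assume "f \<in> ?O"
    then obtain w t d where "f = expsum \<alpha> 0 (orbit_coeff w t + d)" and "0 < t"
        "\<And>j. 0 \<le> fst d $ j" "0 \<le> snd d"
      by (auto simp: nonneg_expsums_def expsum_add)
    then show ?thesis
      using orbit_coeff_add_in_cone by (auto simp: DSONC_eq_image)
  qed
qed

section \<open>Equilibrium points\<close>

text \<open>At \<open>w\<close> all the compared terms equal \<open>t\<close>. For any other
  solution \<open>y\<close>, the quotients show that \<open>y - w\<close> has equal inner products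
  with all vertices.\<close>

lemma equilibrium_orbit_coeff:
  assumes t: "0 < t"
  shows "equilibrium \<alpha> 0 (orbit_coeff w t) = w"
  unfolding equilibrium_def
proof (rule the_equality)
  show "\<forall>i j. fst (orbit_coeff w t) $ i * exp (w \<bullet> (\<alpha> i - 0)) =
      fst (orbit_coeff w t) $ j * exp (w \<bullet> (\<alpha> j - 0))"
    by (simp add: orbit_coeff_def exp_minus)
next
  fix y
  assume y: "\<forall>i j. fst (orbit_coeff w t) $ i * exp (y \<bullet> (\<alpha> i - 0)) =
      fst (orbit_coeff w t) $ j * exp (y \<bullet> (\<alpha> j - 0))"
  have "(y - w) \<bullet> \<alpha> i = (y - w) \<bullet> \<alpha> j" for i j
  proof -
    have "exp ((y - w) \<bullet> \<alpha> i) = exp ((y - w) \<bullet> \<alpha> j)"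
      using y[rule_format, of i j] t
      by (simp add: orbit_coeff_def inner_diff_left exp_diff exp_minus field_simps)
    then show ?thesis by simp
  qed
  then have "y - w = 0" by (rule inner_vertices_const)
  then show "y = w" by simp
qed

end

theorem theorem6p6:
  fixes \<alpha> :: "'k::finite \<Rightarrow> real ^ 'n" and \<beta> :: "real ^ 'n" and lam :: "'k \<Rightarrow> real"
  assumes "circuit \<alpha> \<beta>" and "\<beta> = 0" and "barycentric \<alpha> \<beta> lam"
  shows "(full_support_boundary \<alpha> \<beta> (DSONC \<alpha> \<beta> lam) =
           {(\<lambda>x. translate w (toric \<alpha> \<beta>) x \<bullet> (t *\<^sub>R (1, -1))) | w t. 0 < t}) \<and>
    (DSONC \<alpha> \<beta> lam =
           nonneg_expsums \<alpha> \<beta> \<union>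
           {(\<lambda>x. translate w (toric \<alpha> \<beta>) x \<bullet> (t *\<^sub>R (1, -1)) + h x) | w t h.
              0 < t \<and> h \<in> nonneg_expsums \<alpha> \<beta>}) \<and>
    (\<forall>t>0. equilibrium \<alpha> \<beta> (t *\<^sub>R (1, -1)) = 0) \<and>
    (\<forall>w t c. 0 < t \<longrightarrow>
           expsum \<alpha> \<beta> c = (\<lambda>x. translate w (toric \<alpha> \<beta>) x \<bullet> (t *\<^sub>R (1, -1))) \<longrightarrow>
           (\<forall>j. 0 < fst c $ j) \<and> snd c \<noteq> 0 \<and> equilibrium \<alpha> \<beta> c = w \<and>
           (\<forall>j. \<bar>snd c\<bar> = fst c $ j * exp (equilibrium \<alpha> \<beta> c \<bullet> (\<alpha> j - \<beta>))))"
proof -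
  interpret origin_circuit \<alpha> lam
    using assms by unfold_locales auto
  \<comment> \<open>The untranslated vector is the case \<open>w = 0\<close>, which puts its
    equilibrium at the origin.\<close>
  have "t *\<^sub>R (1, -1) = orbit_coeff 0 t" for t
    by (simp add: orbit_coeff_def vec_eq_iff)
  then have "\<forall>t>0. equilibrium \<alpha> 0 (t *\<^sub>R (1, -1)) = 0"
    using equilibrium_orbit_coeff by simp
  moreover have "(\<forall>j. 0 < fst c $ j) \<and> snd c \<noteq> 0 \<and> equilibrium \<alpha> 0 c = w \<and>
      (\<forall>j. \<bar>snd c\<bar> = fst c $ j * exp (equilibrium \<alpha> 0 c \<bullet> (\<alpha> j - 0)))"
    if t: "0 < t" and "expsum \<alpha> 0 c = expsum \<alpha> 0 (orbit_coeff w t)" for w t c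
  proof -
    \<comment> \<open>Injectivity pins down the coefficients of the given function, so everything
      can be read off the explicit vector.\<close>
    have c: "c = orbit_coeff w t" using that inj_expsum by (simp add: inj_eq)
    show ?thesis
      unfolding c equilibrium_orbit_coeff[OF t] using t by (simp add: orbit_coeff_def exp_minus)
  qed
  ultimately show ?thesis
    unfolding \<open>\<beta> = 0\<close> expsum_orbit_coeff[symmetric]
    by (intro conjI full_support_boundary_eq_orbit DSONC_eq_orbit_plus_nonneg) blast+
qed

end
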